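(* Let $\Psi$ be a $\delta'$-like potential. For each $k>0$ and $\alpha\in\mathbb{R}$, the reflection and transmission coefficients $R_\Psi(\varepsilon k,\alpha)$ and $T_\Psi(\varepsilon k,\alpha)$ converge, as $\varepsilon\to0$ (with $\varepsilon>0$), to $R_\Psi(\alpha)$ and $T_\Psi(\alpha)$ respectively, where $$R_\Psi(\alpha)=\begin{cases}\dfrac{1-\theta_\Psi^2(\alpha)}{1+\theta_\Psi^2(\alpha)} & \text{if }\alpha\in\Sigma_\Psi,\\[2mm] -1 & \text{otherwise,}\end{cases}\qquad T_\Psi(\alpha)=\begin{cases}\dfrac{2\theta_\Psi(\alpha)}{1+\theta_\Psi^2(\alpha)} & \text{if }\alpha\in\Sigma_\Psi,\\[2mm] 0 & \text{otherwise.}\end{cases}$$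
   Context: A (real-valued) function $\Psi\in C_0^\infty(\mathbb{R})$ with $\operatorname{supp}\Psi=[-1,1]$ is called a $\delta'$-like potential if $\int_{\mathbb{R}}\Psi(\xi)\,d\xi=0$ and $\int_{\mathbb{R}}\xi\Psi(\xi)\,d\xi=-1$. The resonant set $\Sigma_\Psi$ is the set of all $\alpha\in\mathbb R$ for which the problem $-w''+\alpha\Psi(\xi)w=0$, $\xi\in(-1,1)$, $w'(-1)=w'(1)=0$, has a non-trivial solution $w_\alpha$ (in particular $0\in\Sigma_\Psi$). The coupling function $\theta_\Psi:\Sigma_\Psi\to\mathbb{R}$ is $\theta_\Psi(\alpha)=w_\alpha(1)/w_\alpha(-1)$, which is well defined, real and independent of the choice of $w_\alpha$ (so $\theta_\Psi(0)=1$). For $k>0$, $\varepsilon>0$, $\alpha\in\mathbb{R}$, consider the solution of $-y''+\alpha\varepsilon^{-2}\Psi(\varepsilon^{-1}x)y=k^2y$ on $\mathbb{R}$ of the form $$\psi_\varepsilon(x,k,\alpha)=\begin{cases}e^{ikx}+R\,e^{-ikx}, & x<-\varepsilon,\\ A\,u(\varepsilon^{-1}x,\varepsilon k,\alpha)+B\,v(\varepsilon^{-1}x,\varepsilon k,\alpha), & |x|<\varepsilon,\\ T\,e^{ikx}, & x>\varepsilon,\end{cases}$$ continuous together with its first derivative at $x=\pm\varepsilon$. Here $u=u(\xi,\varkappa,\alpha)$ and $v=v(\xi,\varkappa,\alpha)$ are the solutions of $-w''+\alpha\Psi(\xi)w=\varkappa^2w$ on $(-1,1)$ with $u(-1,\varkappa,\alpha)=1$,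 $u'(-1,\varkappa,\alpha)=0$ and $v(-1,\varkappa,\alpha)=0$, $v'(-1,\varkappa,\alpha)=1$ (prime denotes the derivative in $\xi$). With $\varkappa:=\varepsilon k$, the matching conditions are the linear system $$\begin{pmatrix}-e^{i\varkappa}&1&0&0\\ i\varkappa e^{i\varkappa}&0&1&0\\ 0&u(1,\varkappa,\alpha)&v(1,\varkappa,\alpha)&-e^{i\varkappa}\\ 0&u'(1,\varkappa,\alpha)&v'(1,\varkappa,\alpha)&-i\varkappa e^{i\varkappa}\end{pmatrix}\begin{pmatrix} R \\ A \\ B \\ T \end{pmatrix}=\begin{pmatrix}e^{-i\varkappa}\\ i\varkappa e^{-i\varkappa}\\ 0\\ 0\end{pmatrix}.$$ Its solution components $R$ and $T$, which depend only on $\varkappa=\varepsilon k$ and $\alpha$ (and $\Psi$), are denoted $R_\Psi(\varepsilon k,\alpha)$ and $T_\Psi(\varepsilon k,\alpha)$. *)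

theory Defs
  imports "HOL-Analysis.Analysis"
begin

definition smooth_real :: "(real \<Rightarrow> real) \<Rightarrow> bool" where
  "smooth_real f \<longleftrightarrow> (\<forall>n x. (deriv ^^ n) f field_differentiable at x)"

definition delta_prime_like :: "(real \<Rightarrow> real) \<Rightarrow> bool" where
  "delta_prime_like \<Psi> \<longleftrightarrow>
     smooth_real \<Psi> \<and>
     closure {\<xi>. \<Psi> \<xi> \<noteq> 0} = {-1..1} \<and>
     (\<Psi> has_integral 0) UNIV \<and>
     ((\<lambda>\<xi>. \<xi> * \<Psi> \<xi>) has_integral (-1)) UNIV"

(* The derivative in \<xi> of a function on [-1,1]; it is one-sided at the end-points. *)
definition dxi :: "(real \<Rightarrow> complex) \<Rightarrow> real \<Rightarrow> complex" where
  "dxi w \<xi> = vector_derivative w (at \<xi> within {-1..1})"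

(* Solutions are C^1 up to the boundary, so that the boundary values of w and w' make
   sense; the equation -w'' + \<alpha> \<Psi> w = \<kappa>^2 w itself is required on the open interval.
   Only the values of w on [-1,1] matter. *)
definition solves :: "(real \<Rightarrow> real) \<Rightarrow> real \<Rightarrow> real \<Rightarrow> (real \<Rightarrow> complex) \<Rightarrow> bool" where
  "solves \<Psi> \<kappa> \<alpha> w \<longleftrightarrow>
     (\<forall>\<xi>\<in>{-1..1}. w differentiable (at \<xi> within {-1..1})) \<and>
     continuous_on {-1..1} (dxi w) \<and>
     (\<forall>\<xi>\<in>{-1<..<1}. dxi w differentiable (at \<xi>) \<and>
        - vector_derivative (dxi w) (at \<xi>) + complex_of_real (\<alpha> * \<Psi> \<xi>) * w \<xi>
          = complex_of_real (\<kappa>\<^sup>2) * w \<xi>)"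

definition resonant_solution :: "(real \<Rightarrow> real) \<Rightarrow> real \<Rightarrow> (real \<Rightarrow> complex) \<Rightarrow> bool" where
  "resonant_solution \<Psi> \<alpha> w \<longleftrightarrow>
     solves \<Psi> 0 \<alpha> w \<and> dxi w (-1) = 0 \<and> dxi w 1 = 0 \<and> (\<exists>\<xi>\<in>{-1..1}. w \<xi> \<noteq> 0)"

definition resonant_set :: "(real \<Rightarrow> real) \<Rightarrow> real set" where
  "resonant_set \<Psi> = {\<alpha>. \<exists>w. resonant_solution \<Psi> \<alpha> w}"

(* Meaningful only for \<alpha> in the resonant set, where the ratio is real and does not depend
   on the resonant solution. *)
definition coupling :: "(real \<Rightarrow> real) \<Rightarrow> real \<Rightarrow> real" where
  "coupling \<Psi> \<alpha> =
     (THE t. \<exists>w. resonant_solution \<Psi> \<alpha> w \<and> complex_of_real t = w 1 / w (-1))"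

(* The fundamental solutions u(\<cdot>,\<kappa>,\<alpha>) and v(\<cdot>,\<kappa>,\<alpha>) are unique on [-1,1];
   SOME is used instead of THE because their values outside [-1,1] are unconstrained. *)
definition sol_u :: "(real \<Rightarrow> real) \<Rightarrow> real \<Rightarrow> real \<Rightarrow> real \<Rightarrow> complex" where
  "sol_u \<Psi> \<kappa> \<alpha> = (SOME w. solves \<Psi> \<kappa> \<alpha> w \<and> w (-1) = 1 \<and> dxi w (-1) = 0)"

definition sol_v :: "(real \<Rightarrow> real) \<Rightarrow> real \<Rightarrow> real \<Rightarrow> real \<Rightarrow> complex" where
  "sol_v \<Psi> \<kappa> \<alpha> = (SOME w. solves \<Psi> \<kappa> \<alpha> w \<and> w (-1) = 0 \<and> dxi w (-1) = 1)"

definition matching_matrix :: "(real \<Rightarrow> real) \<Rightarrow> real \<Rightarrow> real \<Rightarrow> complex ^ 4 ^ 4" where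
  "matching_matrix \<Psi> \<kappa> \<alpha> =
     (let e = exp (\<i> * complex_of_real \<kappa>);
          u = sol_u \<Psi> \<kappa> \<alpha>;
          v = sol_v \<Psi> \<kappa> \<alpha>
      in vector
        [vector [- e, 1, 0, 0],
         vector [\<i> * complex_of_real \<kappa> * e, 0, 1, 0],
         vector [0, u 1, v 1, - e],
         vector [0, dxi u 1, dxi v 1, - \<i> * complex_of_real \<kappa> * e]])"

definition matching_rhs :: "real \<Rightarrow> complex ^ 4" where
  "matching_rhs \<kappa> =
     (let e = exp (- \<i> * complex_of_real \<kappa>) in vector [e, \<i> * complex_of_real \<kappa> * e, 0, 0])"

(* The vector (R, A, B, T). *)
definition scattering_data :: "(real \<Rightarrow> real) \<Rightarrow> real \<Rightarrow> real \<Rightarrow> complex ^ 4" where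
  "scattering_data \<Psi> \<kappa> \<alpha> = (THE x. matching_matrix \<Psi> \<kappa> \<alpha> *v x = matching_rhs \<kappa>)"

definition refl_coeff :: "(real \<Rightarrow> real) \<Rightarrow> real \<Rightarrow> real \<Rightarrow> complex" where
  "refl_coeff \<Psi> \<kappa> \<alpha> = scattering_data \<Psi> \<kappa> \<alpha> $ 1"

definition trans_coeff :: "(real \<Rightarrow> real) \<Rightarrow> real \<Rightarrow> real \<Rightarrow> complex" where
  "trans_coeff \<Psi> \<kappa> \<alpha> = scattering_data \<Psi> \<kappa> \<alpha> $ 4"

definition refl_limit :: "(real \<Rightarrow> real) \<Rightarrow> real \<Rightarrow> real" where
  "refl_limit \<Psi> \<alpha> =
     (if \<alpha> \<in> resonant_set \<Psi>
      then (1 - (coupling \<Psi> \<alpha>)\<^sup>2) / (1 + (coupling \<Psi> \<alpha>)\<^sup>2)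
      else -1)"

definition trans_limit :: "(real \<Rightarrow> real) \<Rightarrow> real \<Rightarrow> real" where
  "trans_limit \<Psi> \<alpha> =
     (if \<alpha> \<in> resonant_set \<Psi>
      then 2 * coupling \<Psi> \<alpha> / (1 + (coupling \<Psi> \<alpha>)\<^sup>2)
      else 0)"

end

theory Submission
  imports Defs
begin

text \<open>
  Let \<open>u\<close>, \<open>v\<close> be the fundamental solutions of \<open>- w'' + \<alpha> \<Psi> w = \<kappa>\<^sup>2 w\<close> and write \<open>a, b, c, d\<close> for the
  values of \<open>u, v, u', v'\<close> at \<open>1\<close>. These are real, and \<open>a d - b c = 1\<close> because the Wronskian is constant.
  Solving the matching system (\<open>scattering_coefficients\<close>) gives, up to the factor \<open>exp (- 2 \<i> \<kappa>)\<close>,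
  \<open>R = - (c + \<kappa>\<^sup>2 b - \<i> \<kappa> (a - d)) / D\<close> and \<open>T = - 2 \<i> \<kappa> / D\<close> with
  \<open>D = c - \<kappa>\<^sup>2 b - \<i> \<kappa> (a + d)\<close>. Everything thus depends on whether \<open>c\<close> vanishes at \<open>\<kappa> = 0\<close>, and
  this is the resonance condition: a solution at \<open>\<kappa> = 0\<close> with \<open>w' (-1) = 0\<close> is a multiple of \<open>u\<close>, so
  it satisfies \<open>w' (1) = 0\<close> exactly when \<open>c = 0\<close>, and then \<open>a\<close> is the coupling constant
  (\<open>resonance\<close>).

  Off resonance \<open>c\<close> dominates the fractions, and \<open>R \<longlongrightarrow> -1\<close>, \<open>T \<longlongrightarrow> 0\<close>. At resonance numerators and
  denominators are of order \<open>\<kappa>\<close>. The boundary values differ from those at \<open>\<kappa> = 0\<close> by \<open>O(\<kappa>\<^sup>2)\<close>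
  (\<open>monodromy_expansion\<close>), so \<open>c\<close> is negligible against \<open>\<kappa>\<close>; the limits are
  \<open>- (a - d) / (a + d)\<close> and \<open>2 / (a + d)\<close>, and \<open>d = 1 / a\<close>.

  The differential equation is treated by hand: real solutions come from a Neumann series
  (\<open>sturm_solution_exists\<close>), while uniqueness and dependence on \<open>\<kappa>\<close> both follow from the Lagrange
  identity \<open>(f' g - f g')' = (q - p) f g\<close> for \<open>f'' = q f\<close> and \<open>g'' = p g\<close>.
\<close>

section \<open>Existence for \<open>w'' = q w\<close> on \<open>[-1,1]\<close>\<close>

text \<open>
  The derivative is carried as a second function \<open>w'\<close>. The field is left open because solutions are
  built over the reals, where the mean value theorem is at hand, while the scattering problem is
  about complex solutions.
\<close>
definition sturm_solution ::
    "(real \<Rightarrow> real) \<Rightarrow> (real \<Rightarrow> 'a::real_normed_field) \<Rightarrow> (real \<Rightarrow> 'a) \<Rightarrow> bool" where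
  "sturm_solution q w w' \<longleftrightarrow>
     continuous_on {-1..1} w' \<and>
     (\<forall>x\<in>{-1..1}. (w has_vector_derivative w' x) (at x within {-1..1})) \<and>
     (\<forall>x\<in>{-1<..<1}. (w' has_vector_derivative of_real (q x) * w x) (at x))"

lemma sturm_solution_continuous_on:
  "sturm_solution q w w' \<Longrightarrow> continuous_on {-1..1} w"
  unfolding sturm_solution_def
  by (meson continuous_on_eq_continuous_within has_vector_derivative_continuous)

text \<open>
  In the weighted norm \<open>sup |g x| exp (- L (x + 1))\<close> integration from \<open>-1\<close> has norm at most
  \<open>1 / L\<close>. A large \<open>L\<close> thus turns Picard iteration into a geometric series.
\<close>
lemma abs_integral_exp_bound:
  fixes g :: "real \<Rightarrow> real"
  assumes "L > 0" and "K \<ge> 0" and cont: "continuous_on {-1..1} g"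
    and bound: "\<And>x. x \<in> {-1..1} \<Longrightarrow> \<bar>g x\<bar> \<le> K * exp (L * (x + 1))"
    and x: "x \<in> {-1..1}"
  shows "\<bar>integral {-1..x} g\<bar> \<le> K / L * exp (L * (x + 1))"
proof -
  have antideriv: "((\<lambda>s. K * exp (L * (s + 1))) has_integral
           (K / L * exp (L * (x + 1)) - K / L * exp (L * (-1 + 1)))) {-1..x}"
    by (rule fundamental_theorem_of_calculus)
       (use x \<open>L > 0\<close> in \<open>auto intro!: derivative_eq_intros simp flip: has_real_derivative_iff_has_vector_derivative\<close>)
  have "integral {-1..x} (\<lambda>s. K * exp (L * (s + 1))) \<le> K / L * exp (L * (x + 1))"
    unfolding integral_unique[OF antideriv] using \<open>L > 0\<close> \<open>K \<ge> 0\<close> by simp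
  moreover note int = has_integral_integrable[OF antideriv]
  moreover have "norm (integral {-1..x} g) \<le> integral {-1..x} (\<lambda>s. K * exp (L * (s + 1)))"
    by (rule integral_norm_bound_integral)
       (use x bound int in \<open>auto intro!: integrable_continuous_real continuous_on_subset[OF cont]\<close>)
  ultimately show ?thesis by simp
qed

text \<open>
  The solution is the Neumann series \<open>w = d\<^sub>0 + d\<^sub>1 + \<dots>\<close>, where \<open>d\<^sub>0\<close> is the affine function with
  the given initial data and \<open>d\<^sub>n\<^sub>+\<^sub>1\<close> is the double integral of \<open>q d\<^sub>n\<close>. Integrating twice gains
  \<open>1 / L\<^sup>2\<close> in the weighted norm, so with \<open>|q| \<le> L\<^sup>2 / 2\<close> every step halves the bound. The series
  of functions, of first and of second derivatives are dominated by a geometric series and may be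
  differentiated term by term. The explicit bound on \<open>w\<close> depends on \<open>q\<close> only through \<open>L\<close>; this
  is what makes the later perturbation estimate uniform.
\<close>
lemma sturm_solution_exists:
  fixes q :: "real \<Rightarrow> real" and p r L :: real
  assumes q: "continuous_on {-1..1} q" and "L \<ge> 1"
    and qL: "\<And>x. x \<in> {-1..1} \<Longrightarrow> \<bar>q x\<bar> \<le> L\<^sup>2 / 2"
  obtains w w' where "sturm_solution q w w'" "w (-1) = p" "w' (-1) = r"
    "\<And>x. x \<in> {-1..1} \<Longrightarrow> \<bar>w x\<bar> \<le> 2 * (\<bar>p\<bar> + 2 * \<bar>r\<bar>) * exp (2 * L)"
proof -
  define E where "E = (\<lambda>f x. integral {-1..x} (\<lambda>s. q s * f s) :: real)"
  define V where "V = (\<lambda>f x. integral {-1..x} (E f) :: real)"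
  \<comment> \<open>\<open>d\<close>, \<open>e\<close> and \<open>e'\<close> are the terms of the series for \<open>w\<close>, \<open>w'\<close> and \<open>w''\<close>; the last two are
    shifted by one index, as the affine term \<open>d 0\<close> has derivatives \<open>r\<close> and \<open>0\<close>.\<close>
  define d where "d n = (V ^^ n) (\<lambda>x. p + r * (x + 1))" for n
  define e where "e n = (case n of 0 \<Rightarrow> (\<lambda>x. r) | Suc m \<Rightarrow> E (d m))" for n
  define e' where "e' n = (case n of 0 \<Rightarrow> (\<lambda>x. 0) | Suc m \<Rightarrow> (\<lambda>x. q x * d m x))" for n
  define C where "C = \<bar>p\<bar> + 2 * \<bar>r\<bar>"
  have L: "L > 0" and C: "C \<ge> 0" using \<open>L \<ge> 1\<close> by (auto simp: C_def)
  have d0: "d 0 = (\<lambda>x. p + r * (x + 1))" and dSuc: "d (Suc n) = V (d n)" for n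
    by (auto simp: d_def)
  have E_deriv: "(E f has_real_derivative q x * f x) (at x within {-1..1})"
    if "continuous_on {-1..1} f" "x \<in> {-1..1}" for f x
    unfolding E_def using that q by (intro integral_has_real_derivative continuous_intros)
  have E_cont: "continuous_on {-1..1} (E f)" if "continuous_on {-1..1} f" for f
    by (rule DERIV_continuous_on[OF E_deriv[OF that]])
  have V_deriv: "(V f has_real_derivative E f x) (at x within {-1..1})"
    if "continuous_on {-1..1} f" "x \<in> {-1..1}" for f x
    unfolding V_def using that E_cont by (intro integral_has_real_derivative) auto
  have d_cont: "continuous_on {-1..1} (d n)" for n
  proof (induction n)
    case 0 show ?case by (auto simp: d0 intro!: continuous_intros)
  next
    case (Suc n) show ?case unfolding dSuc by (rule DERIV_continuous_on[OF V_deriv[OF Suc]])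
  qed
  have d_deriv: "(d n has_real_derivative e n x) (at x within {-1..1})" if "x \<in> {-1..1}" for n x
    by (cases n)
       (use V_deriv[OF d_cont that] in \<open>auto simp: d0 dSuc e_def intro!: derivative_eq_intros\<close>)
  have e_deriv: "(e n has_real_derivative e' n x) (at x within {-1..1})" if "x \<in> {-1..1}" for n x
    by (cases n) (use E_deriv[OF d_cont that] in \<open>auto simp: e_def e'_def\<close>)
  have qd_bound: "\<bar>q x * d n x\<bar> \<le> L\<^sup>2 / 2 * (C / 2 ^ n) * exp (L * (x + 1))"
    if "\<bar>d n x\<bar> \<le> C / 2 ^ n * exp (L * (x + 1))" "x \<in> {-1..1}" for n x
    using mult_mono[OF qL[OF that(2)] that(1)] by (simp add: abs_mult mult.assoc)
  have E_bound: "\<bar>E (d n) x\<bar> \<le> L / 2 * (C / 2 ^ n) * exp (L * (x + 1))"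
    if "\<And>x. x \<in> {-1..1} \<Longrightarrow> \<bar>d n x\<bar> \<le> C / 2 ^ n * exp (L * (x + 1))" "x \<in> {-1..1}" for n x
    using abs_integral_exp_bound[OF L, of "L\<^sup>2 / 2 * (C / 2 ^ n)" "\<lambda>s. q s * d n s" x]
      that C L qd_bound q d_cont
    by (auto simp: E_def power2_eq_square intro!: continuous_intros)
  have d_bound: "\<bar>d n x\<bar> \<le> C / 2 ^ n * exp (L * (x + 1))" if "x \<in> {-1..1}" for n x
    using that
  proof (induction n arbitrary: x)
    case 0
    have "\<bar>d 0 x\<bar> \<le> \<bar>p\<bar> + \<bar>r\<bar> * \<bar>x + 1\<bar>" by (auto simp: d0 abs_mult intro: abs_triangle_ineq[THEN order_trans])
    also have "\<dots> \<le> C"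
      using 0 mult_left_mono[of "\<bar>x + 1\<bar>" 2 "\<bar>r\<bar>"] by (auto simp: C_def)
    also have "\<dots> \<le> C * exp (L * (x + 1))"
      using C L 0 mult_left_mono[of 1 "exp (L * (x + 1))" C] by simp
    finally show ?case by simp
  next
    case (Suc n)
    have "\<bar>d (Suc n) x\<bar> \<le> L / 2 * (C / 2 ^ n) / L * exp (L * (x + 1))"
      unfolding dSuc V_def
      by (rule abs_integral_exp_bound[OF L]) (use L C Suc E_bound E_cont d_cont in auto)
    then show ?case using L by simp
  qed
  define B where "B = exp (2 * L)"
  have B: "B \<ge> 1" "\<And>x. x \<in> {-1..1} \<Longrightarrow> exp (L * (x + 1)) \<le> B"
    using L by (auto simp: B_def)
  have weaken: "K * exp (L * (x + 1)) \<le> K * B" if "K \<ge> 0" "x \<in> {-1..1}" for K x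
    using that B by (intro mult_left_mono) auto
  have d_le: "\<bar>d n x\<bar> \<le> C * B * (1/2) ^ n" if "x \<in> {-1..1}" for n x
    using order_trans[OF d_bound[OF that] weaken] that C
    by (simp add: power_one_over field_simps)
  have e_le: "\<bar>e n x\<bar> \<le> L * C * B * (1/2) ^ n" if "x \<in> {-1..1}" for n x
  proof (cases n)
    case 0
    have "\<bar>r\<bar> \<le> C" using C by (simp add: C_def)
    also have "\<dots> \<le> (L * B) * C"
      using mult_mono[OF \<open>L \<ge> 1\<close> B(1)] mult_right_mono[of 1 "L * B" C] C L by simp
    finally show ?thesis using 0 by (simp add: e_def mult_ac)
  next
    case (Suc m)
    then show ?thesis
      using order_trans[OF E_bound[OF d_bound that] weaken[of "L / 2 * (C / 2 ^ m)" x]] that C L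
      by (simp add: e_def power_one_over field_simps)
  qed
  have e'_le: "\<bar>e' n x\<bar> \<le> L\<^sup>2 * C * B * (1/2) ^ n" if "x \<in> {-1..1}" for n x
  proof (cases n)
    case 0
    then show ?thesis using C B by (simp add: e'_def)
  next
    case (Suc m)
    then show ?thesis
      using order_trans[OF qd_bound[OF d_bound that] weaken[of "L\<^sup>2 / 2 * (C / 2 ^ m)" x]] that C L
      by (simp add: e'_def power_one_over field_simps)
  qed
  have geom: "summable (\<lambda>n. K * (1/2) ^ n :: real)" for K
    by (intro summable_mult summable_geometric) auto
  have summ: "summable (\<lambda>n. d n x)" "summable (\<lambda>n. e n x)" "summable (\<lambda>n. e' n x)"
    if "x \<in> {-1..1}" for x
    using summable_comparison_test'[OF geom, of 0 "\<lambda>n. d n x", unfolded real_norm_def, OF d_le[OF that]]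
      summable_comparison_test'[OF geom, of 0 "\<lambda>n. e n x", unfolded real_norm_def, OF e_le[OF that]]
      summable_comparison_test'[OF geom, of 0 "\<lambda>n. e' n x", unfolded real_norm_def, OF e'_le[OF that]]
    by auto
  define w where "w x = (\<Sum>n. d n x)" for x
  define w' where "w' x = (\<Sum>n. e n x)" for x
  have series: "((\<lambda>x. \<Sum>n. f n x) has_real_derivative (\<Sum>n. f' n x)) (at x within {-1..1})"
    if f: "\<And>n x. x \<in> {-1..1} \<Longrightarrow> (f n has_real_derivative f' n x) (at x within {-1..1})"
      and s: "summable (\<lambda>n. f n 0)" and x: "x \<in> {-1..1}"
      and b: "\<And>n x. x \<in> {-1..1} \<Longrightarrow> \<bar>f' n x\<bar> \<le> K * (1/2) ^ n"
    for f f' :: "nat \<Rightarrow> real \<Rightarrow> real" and K x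
  proof -
    have "uniform_limit {-1..1} (\<lambda>n x. \<Sum>i<n. f' i x) (\<lambda>x. \<Sum>n. f' n x) sequentially"
      using b by (intro Weierstrass_m_test[OF _ geom[of K]]) auto
    from has_field_derivative_series[OF _ f this _ s] obtain g where
      g: "\<forall>x\<in>{-1..1}. (\<lambda>n. f n x) sums g x \<and>
            (g has_real_derivative (\<Sum>n. f' n x)) (at x within {-1..1})"
      by auto
    show ?thesis
      unfolding has_field_derivative_def
      by (rule has_derivative_transform[OF x, where f = g])
         (use g x in \<open>auto simp: sums_iff has_field_derivative_def\<close>)
  qed
  have w_deriv: "(w has_real_derivative w' x) (at x within {-1..1})" if "x \<in> {-1..1}" for x
    unfolding w_def w'_def by (rule series[OF d_deriv _ that e_le]) (auto intro: summ)
  have "(\<Sum>n. e' n x) = q x * w x" if "x \<in> {-1..1}" for x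
  proof -
    have "(\<lambda>n. q x * d n x) sums (q x * w x)"
      unfolding w_def by (intro sums_mult summable_sums summ that)
    then have "(\<lambda>n. e' (Suc n) x) sums (q x * w x)" by (simp add: e'_def)
    then have "(\<lambda>n. e' n x) sums (q x * w x + e' 0 x)" by (rule sums_Suc)
    then show ?thesis by (simp add: e'_def sums_iff)
  qed
  then have w'_deriv: "(w' has_real_derivative q x * w x) (at x within {-1..1})"
    if "x \<in> {-1..1}" for x
    using series[OF e_deriv _ that e'_le] that summ(2)[of 0] unfolding w'_def by simp
  have "sturm_solution q w w'"
    unfolding sturm_solution_def
  proof (intro conjI ballI)
    show "continuous_on {-1..1} w'" by (rule DERIV_continuous_on[OF w'_deriv])
    show "(w has_vector_derivative w' x) (at x within {-1..1})" if "x \<in> {-1..1}" for x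
      using w_deriv[OF that] by (simp add: has_real_derivative_iff_has_vector_derivative)
    show "(w' has_vector_derivative of_real (q x) * w x) (at x)" if "x \<in> {-1<..<1}" for x
      using w'_deriv[of x] that at_within_interior[of x "{-1..1::real}"]
      by (auto simp: has_real_derivative_iff_has_vector_derivative)
  qed
  moreover have "w (-1) = p"
  proof -
    have "w (-1) = (\<Sum>n\<in>{0}. d n (-1))"
      unfolding w_def
    proof (rule suminf_finite)
      fix n :: nat assume "n \<notin> {0}"
      then show "d n (-1) = 0" by (cases n) (auto simp: dSuc V_def)
    qed auto
    then show ?thesis by (simp add: d0)
  qed
  moreover have "w' (-1) = r"
  proof -
    have "w' (-1) = (\<Sum>n\<in>{0}. e n (-1))"
      unfolding w'_def
      by (rule suminf_finite) (auto simp: e_def E_def split: nat.splits)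
    then show ?thesis by (simp add: e_def)
  qed
  moreover have "\<bar>w x\<bar> \<le> 2 * (\<bar>p\<bar> + 2 * \<bar>r\<bar>) * exp (2 * L)" if "x \<in> {-1..1}" for x
  proof -
    have "norm (w x) \<le> (\<Sum>n. C * B * (1/2) ^ n)"
      unfolding w_def using d_le[OF that] by (intro norm_suminf_le geom) auto
    also have "\<dots> = C * B * 2" by (subst suminf_mult) (auto simp: suminf_geometric)
    finally show ?thesis by (simp only: C_def B_def mult_ac real_norm_def)
  qed
  ultimately show ?thesis using that by blast
qed

section \<open>The Wronskian and perturbation of the coefficient\<close>
lemma lagrange_identity:
  assumes "sturm_solution q f f'" "sturm_solution p g g'" "x \<in> {-1<..<1}"
  shows "((\<lambda>x. f' x * g x - f x * g' x) has_vector_derivative of_real (q x - p x) * (f x * g x)) (at x)"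
proof -
  have at: "at x within {-1..1} = at x"
    using assms(3) by (intro at_within_interior) auto
  have "(f has_vector_derivative f' x) (at x within {-1..1})"
    and "(g has_vector_derivative g' x) (at x within {-1..1})"
    and f: "(f' has_vector_derivative of_real (q x) * f x) (at x)"
    and g: "(g' has_vector_derivative of_real (p x) * g x) (at x)"
    using assms by (auto simp: sturm_solution_def)
  then have f: "(f' has_vector_derivative of_real (q x) * f x) (at x)" "(f has_vector_derivative f' x) (at x)"
    and g: "(g' has_vector_derivative of_real (p x) * g x) (at x)" "(g has_vector_derivative g' x) (at x)"
    by (simp_all only: at)
  show ?thesis
    by (rule has_vector_derivative_eq_rhs[OF has_vector_derivative_diff[OF
          has_vector_derivative_mult[OF f(1) g(2)] has_vector_derivative_mult[OF f(2) g(1)]]])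
       (simp add: algebra_simps)
qed

lemma wronskian_continuous_on:
  assumes "sturm_solution q f f'" "sturm_solution p g g'"
  shows "continuous_on {-1..1} (\<lambda>x. f' x * g x - f x * g' x)"
  using assms sturm_solution_continuous_on[OF assms(1)] sturm_solution_continuous_on[OF assms(2)]
  by (intro continuous_intros) (auto simp: sturm_solution_def)

text \<open>
  The equation holds only on the open interval, so the derivative of the Wronskian vanishes only
  there; continuity up to the end-points carries the constant over.
\<close>
lemma wronskian_constant:
  fixes f g :: "real \<Rightarrow> 'a::{real_normed_field, banach}"
  assumes f: "sturm_solution q f f'" and g: "sturm_solution q g g'" and "x \<in> {-1..1}"
  shows "f' x * g x - f x * g' x = f' (-1) * g (-1) - f (-1) * g' (-1)"
proof (rule has_derivative_zero_unique_strong_interval[of "{-1, 1}" "-1" 1 "\<lambda>x. f' x * g x - f x * g' x"])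
  show "continuous_on {-1..1} (\<lambda>x. f' x * g x - f x * g' x)"
    by (rule wronskian_continuous_on[OF f g])
  show "((\<lambda>x. f' x * g x - f x * g' x) has_derivative (\<lambda>h. 0)) (at x within {-1..1})"
    if "x \<in> {-1..1} - {-1, 1}" for x
    using lagrange_identity[OF f g, of x] that
    by (auto simp: has_vector_derivative_def intro: has_derivative_at_withinI)
qed (use assms in auto)

text \<open>
  For two different coefficients the Wronskian moves by at most the length \<open>2\<close> of the interval times
  a bound for its derivative, which the Lagrange identity gives as \<open>(q - p) f g\<close>.
\<close>
lemma wronskian_variation:
  fixes f g :: "real \<Rightarrow> real"
  assumes f: "sturm_solution q f f'" and g: "sturm_solution p g g'"
    and "\<And>x. x \<in> {-1..1} \<Longrightarrow> \<bar>f x\<bar> \<le> A" "\<And>x. x \<in> {-1..1} \<Longrightarrow> \<bar>g x\<bar> \<le> B"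
    and "\<And>x. x \<in> {-1..1} \<Longrightarrow> \<bar>q x - p x\<bar> \<le> \<delta>"
  shows "\<bar>(f' 1 * g 1 - f 1 * g' 1) - (f' (-1) * g (-1) - f (-1) * g' (-1))\<bar> \<le> 2 * \<delta> * A * B"
proof -
  have deriv: "((\<lambda>x. f' x * g x - f x * g' x) has_derivative
      (\<lambda>h. h * ((q x - p x) * (f x * g x)))) (at x)" if "-1 < x" "x < 1" for x
    using lagrange_identity[OF f g, of x] that by (simp add: has_vector_derivative_def)
  obtain x where x: "x \<in> {-1<..<1}"
    "(f' 1 * g 1 - f 1 * g' 1) - (f' (-1) * g (-1) - f (-1) * g' (-1))
       = 2 * ((q x - p x) * (f x * g x))"
    using mvt[OF _ wronskian_continuous_on[OF f g] deriv] by auto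
  have "\<bar>q x - p x\<bar> * (\<bar>f x\<bar> * \<bar>g x\<bar>) \<le> \<delta> * (A * B)"
    using assms(3-5)[of x] x(1) by (intro mult_mono) auto
  then show ?thesis unfolding x(2) abs_mult by (simp add: mult.assoc)
qed

definition fundamental_pair ::
    "(real \<Rightarrow> real) \<Rightarrow> (real \<Rightarrow> 'a::real_normed_field) \<Rightarrow> (real \<Rightarrow> 'a)
       \<Rightarrow> (real \<Rightarrow> 'a) \<Rightarrow> (real \<Rightarrow> 'a) \<Rightarrow> bool" where
  "fundamental_pair q f f' g g' \<longleftrightarrow>
     sturm_solution q f f' \<and> f (-1) = 1 \<and> f' (-1) = 0 \<and>
     sturm_solution q g g' \<and> g (-1) = 0 \<and> g' (-1) = 1"

lemma fundamental_pair_wronskian: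
  fixes f g :: "real \<Rightarrow> 'a::{real_normed_field, banach}"
  assumes "fundamental_pair q f f' g g'" "x \<in> {-1..1}"
  shows "f x * g' x - g x * f' x = 1"
  using wronskian_constant[of q f f' g g' x] assms
  by (simp add: fundamental_pair_def algebra_simps)

text \<open>
  The two Wronskians of \<open>w\<close> with \<open>f\<close> and \<open>g\<close> are constant, hence known from the data at \<open>-1\<close>. At each
  point they form a linear system for \<open>w\<close> and \<open>w'\<close> of determinant \<open>1\<close>, and Cramer's rule solves it.
  This is the uniqueness theorem for the initial value problem.
\<close>
lemma sturm_solution_expansion:
  fixes f g w :: "real \<Rightarrow> 'a::{real_normed_field, banach}"
  assumes fg: "fundamental_pair q f f' g g'" and w: "sturm_solution q w w'" and x: "x \<in> {-1..1}"
  shows "w x = w (-1) * f x + w' (-1) * g x" "w' x = w (-1) * f' x + w' (-1) * g' x"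
proof -
  have 1: "w' x * f x - w x * f' x = w' (-1)" "w x * g' x - w' x * g x = w (-1)"
    using wronskian_constant[OF w, of f f' x] wronskian_constant[OF w, of g g' x] fg x
    by (simp_all add: fundamental_pair_def algebra_simps)
  note 2 = fundamental_pair_wronskian[OF fg x]
  have "w (-1) * f x + w' (-1) * g x = w x * (f x * g' x - g x * f' x)"
    unfolding 1[symmetric] by (simp add: algebra_simps)
  then show "w x = w (-1) * f x + w' (-1) * g x" by (simp add: 2)
  have "w (-1) * f' x + w' (-1) * g' x = w' x * (f x * g' x - g x * f' x)"
    unfolding 1[symmetric] by (simp add: algebra_simps)
  then show "w' x = w (-1) * f' x + w' (-1) * g' x" by (simp add: 2)
qed

text \<open>
  The same Cramer argument for a solution \<open>w\<close> of a nearby equation: its Wronskians with \<open>f\<close> and \<open>g\<close>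
  are now constant up to \<open>2 \<delta> B\<^sup>2\<close>, and the two defects \<open>r\<close> and \<open>s\<close> enter the solved system
  linearly. Values at \<open>1\<close> therefore depend on the coefficient in a Lipschitz way, without Gronwall's
  inequality.
\<close>
lemma fundamental_pair_perturbation:
  fixes f g w :: "real \<Rightarrow> real"
  assumes fg: "fundamental_pair p f f' g g'" and w: "sturm_solution q w w'"
    and bounds: "\<And>x. x \<in> {-1..1} \<Longrightarrow> \<bar>w x\<bar> \<le> B" "\<And>x. x \<in> {-1..1} \<Longrightarrow> \<bar>f x\<bar> \<le> B"
      "\<And>x. x \<in> {-1..1} \<Longrightarrow> \<bar>g x\<bar> \<le> B"
    and \<delta>: "\<And>x. x \<in> {-1..1} \<Longrightarrow> \<bar>q x - p x\<bar> \<le> \<delta>"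
  shows "\<bar>w 1 - (w (-1) * f 1 + w' (-1) * g 1)\<bar> \<le> 2 * \<delta> * B * B * (\<bar>f 1\<bar> + \<bar>g 1\<bar>)"
    "\<bar>w' 1 - (w (-1) * f' 1 + w' (-1) * g' 1)\<bar> \<le> 2 * \<delta> * B * B * (\<bar>f' 1\<bar> + \<bar>g' 1\<bar>)"
proof -
  have f: "sturm_solution p f f'" and g: "sturm_solution p g g'"
    using fg by (auto simp: fundamental_pair_def)
  define r where "r = (w' 1 * f 1 - w 1 * f' 1) - w' (-1)"
  define s where "s = (w' 1 * g 1 - w 1 * g' 1) + w (-1)"
  have r: "\<bar>r\<bar> \<le> 2 * \<delta> * B * B" and s: "\<bar>s\<bar> \<le> 2 * \<delta> * B * B"
    using wronskian_variation[OF w f bounds(1,2) \<delta>] wronskian_variation[OF w g bounds(1,3) \<delta>] fg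
    by (auto simp: fundamental_pair_def r_def s_def)
  have W: "f 1 * g' 1 - g 1 * f' 1 = 1" using fundamental_pair_wronskian[OF fg, of 1] by simp
  have combine: "\<bar>y * r - z * s\<bar> \<le> 2 * \<delta> * B * B * (\<bar>z\<bar> + \<bar>y\<bar>)" for y z
    using mult_left_mono[OF r, of "\<bar>y\<bar>"] mult_left_mono[OF s, of "\<bar>z\<bar>"]
      abs_triangle_ineq4[of "y * r" "z * s"] by (simp add: abs_mult algebra_simps)
  have "w 1 - (w (-1) * f 1 + w' (-1) * g 1) = g 1 * r - f 1 * s"
    unfolding r_def s_def using W by algebra
  moreover have "w' 1 - (w (-1) * f' 1 + w' (-1) * g' 1) = g' 1 * r - f' 1 * s"
    unfolding r_def s_def using W by algebra
  ultimately show "\<bar>w 1 - (w (-1) * f 1 + w' (-1) * g 1)\<bar> \<le> 2 * \<delta> * B * B * (\<bar>f 1\<bar> + \<bar>g 1\<bar>)"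
    "\<bar>w' 1 - (w (-1) * f' 1 + w' (-1) * g' 1)\<bar> \<le> 2 * \<delta> * B * B * (\<bar>f' 1\<bar> + \<bar>g' 1\<bar>)"
    using combine by simp_all
qed

text \<open>
  For \<open>|\<kappa>| \<le> 1\<close> the coefficients have a common bound, so one \<open>L\<close> serves them all. The uniform \<open>B\<close>
  is needed when the pair for \<open>\<kappa>\<close> is compared with the pair for \<open>0\<close>.
\<close>
lemma fundamental_pairs_exist:
  assumes "continuous_on {-1..1} \<Psi>"
  obtains B where "\<And>\<kappa>. \<bar>\<kappa>\<bar> \<le> 1 \<Longrightarrow> \<exists>f f' g g' :: real \<Rightarrow> real.
    fundamental_pair (\<lambda>x. \<alpha> * \<Psi> x - \<kappa>\<^sup>2) f f' g g' \<and> (\<forall>x\<in>{-1..1}. \<bar>f x\<bar> \<le> B \<and> \<bar>g x\<bar> \<le> B)"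
proof -
  have "bounded (\<Psi> ` {-1..1})"
    using assms by (intro compact_imp_bounded compact_continuous_image) auto
  then obtain M where M: "\<forall>x\<in>{-1..1}. \<bar>\<Psi> x\<bar> \<le> M"
    unfolding bounded_iff by auto
  define N where "N = \<bar>\<alpha>\<bar> * M + 1"
  have "M \<ge> 0" using bspec[OF M, of 0] by simp
  then have "N \<ge> 1" by (simp add: N_def)
  \<comment> \<open>\<open>N \<ge> 1\<close> bounds the coefficient for all \<open>|\<kappa>| \<le> 1\<close>, and \<open>N \<le> (2 N)\<^sup>2 / 2\<close>.\<close>
  define L where "L = 2 * N"
  have L: "L \<ge> 1" "N \<le> L\<^sup>2 / 2"
    using \<open>N \<ge> 1\<close> mult_mono[of 1 N 1 N] mult_left_mono[of 1 N N]
    by (auto simp: L_def power2_eq_square)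
  show ?thesis
  proof (rule that[of "4 * exp (2 * L)"])
    fix \<kappa> :: real assume "\<bar>\<kappa>\<bar> \<le> 1"
    let ?q = "\<lambda>x. \<alpha> * \<Psi> x - \<kappa>\<^sup>2"
    have cont: "continuous_on {-1..1} ?q" using assms by (intro continuous_intros)
    have bound: "\<bar>?q x\<bar> \<le> L\<^sup>2 / 2" if "x \<in> {-1..1}" for x
    proof -
      have "\<bar>?q x\<bar> \<le> \<bar>\<alpha>\<bar> * \<bar>\<Psi> x\<bar> + \<bar>\<kappa>\<^sup>2\<bar>" unfolding abs_mult[symmetric] by (rule abs_triangle_ineq4)
      also have "\<dots> \<le> N" unfolding N_def
        using M that \<open>\<bar>\<kappa>\<bar> \<le> 1\<close> by (intro add_mono mult_left_mono) (auto simp: abs_square_le_1)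
      finally show ?thesis using L by simp
    qed
    obtain f f' where f: "sturm_solution ?q f f'" "f (-1) = 1" "f' (-1) = 0"
      "\<And>x. x \<in> {-1..1} \<Longrightarrow> \<bar>f x\<bar> \<le> 2 * (\<bar>1\<bar> + 2 * \<bar>0\<bar>) * exp (2 * L)"
      using sturm_solution_exists[OF cont L(1) bound] by blast
    obtain g g' where g: "sturm_solution ?q g g'" "g (-1) = 0" "g' (-1) = 1"
      "\<And>x. x \<in> {-1..1} \<Longrightarrow> \<bar>g x\<bar> \<le> 2 * (\<bar>0\<bar> + 2 * \<bar>1\<bar>) * exp (2 * L)"
      using sturm_solution_exists[OF cont L(1) bound] by blast
    have "\<bar>f x\<bar> \<le> 4 * exp (2 * L)" if "x \<in> {-1..1}" for x
      using f(4)[OF that] exp_gt_zero[of "2 * L"] by simp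
    then show "\<exists>f f' g g' :: real \<Rightarrow> real. fundamental_pair ?q f f' g g' \<and>
        (\<forall>x\<in>{-1..1}. \<bar>f x\<bar> \<le> 4 * exp (2 * L) \<and> \<bar>g x\<bar> \<le> 4 * exp (2 * L))"
      using f g by (intro exI[of _ f] exI[of _ f'] exI[of _ g] exI[of _ g']) (auto simp: fundamental_pair_def)
  qed
qed

text \<open>
  The values \<open>a, b, c, d\<close> of \<open>u, v, u', v'\<close> at \<open>1\<close>. Since \<open>\<kappa>\<close> enters the equation only through
  \<open>\<kappa>\<^sup>2\<close>, they change by \<open>O(\<kappa>\<^sup>2)\<close>. At a resonance \<open>c 0 = 0\<close>, and then this order, rather than mere
  continuity, is what gives \<open>c \<kappa> / \<kappa> \<longlongrightarrow> 0\<close>.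
\<close>
lemma monodromy_expansion:
  assumes \<Psi>: "continuous_on {-1..1} \<Psi>"
  obtains a b c d :: "real \<Rightarrow> real" and K where
    "\<And>\<kappa>. \<bar>\<kappa>\<bar> \<le> 1 \<Longrightarrow> \<exists>f f' g g' :: real \<Rightarrow> real. fundamental_pair (\<lambda>x. \<alpha> * \<Psi> x - \<kappa>\<^sup>2) f f' g g' \<and>
       f 1 = a \<kappa> \<and> g 1 = b \<kappa> \<and> f' 1 = c \<kappa> \<and> g' 1 = d \<kappa>"
    "\<And>\<kappa>. \<bar>\<kappa>\<bar> \<le> 1 \<Longrightarrow> \<bar>a \<kappa> - a 0\<bar> \<le> K * \<kappa>\<^sup>2 \<and> \<bar>b \<kappa> - b 0\<bar> \<le> K * \<kappa>\<^sup>2 \<and>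
       \<bar>c \<kappa> - c 0\<bar> \<le> K * \<kappa>\<^sup>2 \<and> \<bar>d \<kappa> - d 0\<bar> \<le> K * \<kappa>\<^sup>2"
proof -
  obtain B where "\<And>\<kappa>. \<bar>\<kappa>\<bar> \<le> 1 \<Longrightarrow> \<exists>f f' g g' :: real \<Rightarrow> real.
    fundamental_pair (\<lambda>x. \<alpha> * \<Psi> x - \<kappa>\<^sup>2) f f' g g' \<and> (\<forall>x\<in>{-1..1}. \<bar>f x\<bar> \<le> B \<and> \<bar>g x\<bar> \<le> B)"
    using fundamental_pairs_exist[OF \<Psi>] by blast
  then obtain f f' g g' :: "real \<Rightarrow> real \<Rightarrow> real" where
    fg: "\<And>\<kappa>. \<bar>\<kappa>\<bar> \<le> 1 \<Longrightarrow> fundamental_pair (\<lambda>x. \<alpha> * \<Psi> x - \<kappa>\<^sup>2) (f \<kappa>) (f' \<kappa>) (g \<kappa>) (g' \<kappa>)"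
    and bound: "\<And>\<kappa> x. \<bar>\<kappa>\<bar> \<le> 1 \<Longrightarrow> x \<in> {-1..1} \<Longrightarrow> \<bar>f \<kappa> x\<bar> \<le> B \<and> \<bar>g \<kappa> x\<bar> \<le> B"
    by metis
  define S where "S = \<bar>f 0 1\<bar> + \<bar>g 0 1\<bar> + \<bar>f' 0 1\<bar> + \<bar>g' 0 1\<bar>"
  show ?thesis
  proof (rule that[of "\<lambda>\<kappa>. f \<kappa> 1" "\<lambda>\<kappa>. g \<kappa> 1" "\<lambda>\<kappa>. f' \<kappa> 1" "\<lambda>\<kappa>. g' \<kappa> 1" "2 * B * B * S"])
    fix \<kappa> :: real assume \<kappa>: "\<bar>\<kappa>\<bar> \<le> 1"
    then show "\<exists>fa f'a ga g'a. fundamental_pair (\<lambda>x. \<alpha> * \<Psi> x - \<kappa>\<^sup>2) fa f'a ga g'a \<and>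
        fa 1 = f \<kappa> 1 \<and> ga 1 = g \<kappa> 1 \<and> f'a 1 = f' \<kappa> 1 \<and> g'a 1 = g' \<kappa> 1"
      using fg by blast
    have b: "\<bar>f 0 x\<bar> \<le> B" "\<bar>g 0 x\<bar> \<le> B" "\<bar>f \<kappa> x\<bar> \<le> B" "\<bar>g \<kappa> x\<bar> \<le> B" if "x \<in> {-1..1}" for x
      using bound[OF _ that] \<kappa> by auto
    have f: "sturm_solution (\<lambda>x. \<alpha> * \<Psi> x - \<kappa>\<^sup>2) (f \<kappa>) (f' \<kappa>)" "f \<kappa> (-1) = 1" "f' \<kappa> (-1) = 0"
      and g: "sturm_solution (\<lambda>x. \<alpha> * \<Psi> x - \<kappa>\<^sup>2) (g \<kappa>) (g' \<kappa>)" "g \<kappa> (-1) = 0" "g' \<kappa> (-1) = 1"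
      using fg[OF \<kappa>] by (auto simp: fundamental_pair_def)
    have fg0: "fundamental_pair (\<lambda>x. \<alpha> * \<Psi> x - 0\<^sup>2) (f 0) (f' 0) (g 0) (g' 0)"
      by (rule fg) simp
    have \<delta>: "\<bar>\<alpha> * \<Psi> x - \<kappa>\<^sup>2 - (\<alpha> * \<Psi> x - 0\<^sup>2)\<bar> \<le> \<kappa>\<^sup>2" if "x \<in> {-1..1}" for x by simp
    have enlarge: "t \<le> 2 * B * B * S * \<kappa>\<^sup>2" if "t \<le> 2 * \<kappa>\<^sup>2 * B * B * s" "s \<le> S" for s t
    proof -
      have "2 * \<kappa>\<^sup>2 * B * B * s \<le> 2 * \<kappa>\<^sup>2 * B * B * S"
        using that(2) b(1)[of 0] by (intro mult_left_mono mult_nonneg_nonneg) auto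
      then show ?thesis using that(1) by (simp add: mult_ac)
    qed
    show "\<bar>f \<kappa> 1 - f 0 1\<bar> \<le> 2 * B * B * S * \<kappa>\<^sup>2 \<and> \<bar>g \<kappa> 1 - g 0 1\<bar> \<le> 2 * B * B * S * \<kappa>\<^sup>2 \<and>
        \<bar>f' \<kappa> 1 - f' 0 1\<bar> \<le> 2 * B * B * S * \<kappa>\<^sup>2 \<and> \<bar>g' \<kappa> 1 - g' 0 1\<bar> \<le> 2 * B * B * S * \<kappa>\<^sup>2"
      using enlarge[OF fundamental_pair_perturbation(1)[OF fg0 f(1) b(3,1,2) \<delta>]]
        enlarge[OF fundamental_pair_perturbation(2)[OF fg0 f(1) b(3,1,2) \<delta>]]
        enlarge[OF fundamental_pair_perturbation(1)[OF fg0 g(1) b(4,1,2) \<delta>]]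
        enlarge[OF fundamental_pair_perturbation(2)[OF fg0 g(1) b(4,1,2) \<delta>]] f g
      by (simp add: S_def)
  qed
qed

section \<open>Complex solutions, boundary values and resonances\<close>
lemma sturm_solution_of_real:
  fixes f f' :: "real \<Rightarrow> real"
  assumes "sturm_solution q f f'"
  shows "sturm_solution q (\<lambda>x. complex_of_real (f x)) (\<lambda>x. complex_of_real (f' x))"
  using assms unfolding sturm_solution_def
  by (auto intro!: continuous_intros has_vector_derivative_of_real 
      simp flip: of_real_mult simp: has_real_derivative_iff_has_vector_derivative)

lemma dxi_eq:
  assumes "sturm_solution q w w'" "x \<in> {-1..1}"
  shows "dxi w x = w' x"
  unfolding dxi_def
  by (rule vector_derivative_within_closed_interval) (use assms in \<open>auto simp: sturm_solution_def\<close>)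

lemma solves_iff: "solves \<Psi> \<kappa> \<alpha> w \<longleftrightarrow> sturm_solution (\<lambda>x. \<alpha> * \<Psi> x - \<kappa>\<^sup>2) w (dxi w)"
proof -
  have "(\<forall>\<xi>\<in>{-1..1}. w differentiable (at \<xi> within {-1..1})) \<longleftrightarrow>
      (\<forall>\<xi>\<in>{-1..1}. (w has_vector_derivative dxi w \<xi>) (at \<xi> within {-1..1}))"
    unfolding dxi_def by (simp add: vector_derivative_works)
  moreover have "(dxi w differentiable (at \<xi>) \<and>
        - vector_derivative (dxi w) (at \<xi>) + complex_of_real (\<alpha> * \<Psi> \<xi>) * w \<xi>
          = complex_of_real (\<kappa>\<^sup>2) * w \<xi>) \<longleftrightarrow>
      (dxi w has_vector_derivative of_real (\<alpha> * \<Psi> \<xi> - \<kappa>\<^sup>2) * w \<xi>) (at \<xi>)" (is "?L \<longleftrightarrow> ?R") for \<xi>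
  proof
    assume L: ?L
    then have "vector_derivative (dxi w) (at \<xi>) = of_real (\<alpha> * \<Psi> \<xi> - \<kappa>\<^sup>2) * w \<xi>"
      by (simp add: algebra_simps)
    then show ?R using L vector_derivative_works[of "dxi w" "at \<xi>"] by metis
  next
    assume R: ?R
    then have "vector_derivative (dxi w) (at \<xi>) = of_real (\<alpha> * \<Psi> \<xi> - \<kappa>\<^sup>2) * w \<xi>"
      by (rule vector_derivative_at)
    then show ?L using differentiableI_vector[OF R] by (simp add: algebra_simps)
  qed
  ultimately show ?thesis unfolding solves_def sturm_solution_def by auto
qed

text \<open>
  The work is in replacing \<open>w'\<close> by \<open>dxi w\<close>: the two agree on \<open>[-1,1]\<close> only, which is enough as the
  second derivative is taken on the open interval.
\<close>
lemma sturm_solution_imp_solves: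
  assumes "sturm_solution (\<lambda>x. \<alpha> * \<Psi> x - \<kappa>\<^sup>2) w w'"
  shows "solves \<Psi> \<kappa> \<alpha> w"
proof -
  note eq = dxi_eq[OF assms]
  have "(dxi w has_vector_derivative of_real (\<alpha> * \<Psi> x - \<kappa>\<^sup>2) * w x) (at x)" if "x \<in> {-1<..<1}" for x
    by (rule has_vector_derivative_transform_within_open[where S = "{-1<..<1}" and f = w'])
       (use assms that eq in \<open>auto simp: sturm_solution_def\<close>)
  moreover have "continuous_on {-1..1} (dxi w)"
    by (subst continuous_on_cong[OF refl eq]) (use assms in \<open>auto simp: sturm_solution_def\<close>)
  ultimately show ?thesis
    unfolding solves_iff using assms eq by (simp add: sturm_solution_def)
qed

lemma fundamental_pair_of_real:
  fixes f f' g g' :: "real \<Rightarrow> real"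
  assumes "fundamental_pair q f f' g g'"
  shows "fundamental_pair q (\<lambda>x. complex_of_real (f x)) (\<lambda>x. complex_of_real (f' x))
    (\<lambda>x. complex_of_real (g x)) (\<lambda>x. complex_of_real (g' x))"
  using assms by (simp add: fundamental_pair_def sturm_solution_of_real)

text \<open>
  \<open>sol_u\<close> and \<open>sol_v\<close> are chosen among complex solutions with prescribed data at \<open>-1\<close>. Expanding
  them in a real fundamental pair shows that their boundary values are real and known.
\<close>
lemma sol_values:
  fixes f f' g g' :: "real \<Rightarrow> real"
  assumes "fundamental_pair (\<lambda>x. \<alpha> * \<Psi> x - \<kappa>\<^sup>2) f f' g g'"
  shows "sol_u \<Psi> \<kappa> \<alpha> 1 = of_real (f 1)" "dxi (sol_u \<Psi> \<kappa> \<alpha>) 1 = of_real (f' 1)"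
    "sol_v \<Psi> \<kappa> \<alpha> 1 = of_real (g 1)" "dxi (sol_v \<Psi> \<kappa> \<alpha>) 1 = of_real (g' 1)"
proof -
  let ?f = "\<lambda>x. complex_of_real (f x)" and ?g = "\<lambda>x. complex_of_real (g x)"
  note fg = fundamental_pair_of_real[OF assms]
  have f: "sturm_solution (\<lambda>x. \<alpha> * \<Psi> x - \<kappa>\<^sup>2) ?f (\<lambda>x. complex_of_real (f' x))"
    and g: "sturm_solution (\<lambda>x. \<alpha> * \<Psi> x - \<kappa>\<^sup>2) ?g (\<lambda>x. complex_of_real (g' x))"
    using fg by (auto simp: fundamental_pair_def)
  have *: "solves \<Psi> \<kappa> \<alpha> ?f" "dxi ?f (-1) = 0" "?f (-1) = 1"
    "solves \<Psi> \<kappa> \<alpha> ?g" "dxi ?g (-1) = 1" "?g (-1) = 0"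
    using sturm_solution_imp_solves[OF f] dxi_eq[OF f, of "-1"]
      sturm_solution_imp_solves[OF g] dxi_eq[OF g, of "-1"] assms
    by (simp_all add: fundamental_pair_def)
  have u: "solves \<Psi> \<kappa> \<alpha> (sol_u \<Psi> \<kappa> \<alpha>) \<and> sol_u \<Psi> \<kappa> \<alpha> (-1) = 1 \<and> dxi (sol_u \<Psi> \<kappa> \<alpha>) (-1) = 0"
    unfolding sol_u_def by (rule someI[of _ ?f]) (use * in simp)
  have v: "solves \<Psi> \<kappa> \<alpha> (sol_v \<Psi> \<kappa> \<alpha>) \<and> sol_v \<Psi> \<kappa> \<alpha> (-1) = 0 \<and> dxi (sol_v \<Psi> \<kappa> \<alpha>) (-1) = 1"
    unfolding sol_v_def by (rule someI[of _ ?g]) (use * in simp)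
  show "sol_u \<Psi> \<kappa> \<alpha> 1 = of_real (f 1)" "dxi (sol_u \<Psi> \<kappa> \<alpha>) 1 = of_real (f' 1)"
    "sol_v \<Psi> \<kappa> \<alpha> 1 = of_real (g 1)" "dxi (sol_v \<Psi> \<kappa> \<alpha>) 1 = of_real (g' 1)"
    using u v sturm_solution_expansion[OF fg, of "sol_u \<Psi> \<kappa> \<alpha>" "dxi (sol_u \<Psi> \<kappa> \<alpha>)" 1]
       sturm_solution_expansion[OF fg, of "sol_v \<Psi> \<kappa> \<alpha>" "dxi (sol_v \<Psi> \<kappa> \<alpha>)" 1]
    by (simp_all add: solves_iff)
qed

text \<open>
  A solution with \<open>w' (-1) = 0\<close> is the multiple \<open>w (-1) f\<close> of the first fundamental solution. So the
  Neumann problem is solvable precisely when \<open>f' 1 = 0\<close>, and \<open>w 1 / w (-1)\<close> is then \<open>f 1\<close>.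
\<close>
lemma resonance:
  fixes f f' g g' :: "real \<Rightarrow> real"
  assumes "fundamental_pair (\<lambda>x. \<alpha> * \<Psi> x - 0\<^sup>2) f f' g g'"
  shows "\<alpha> \<in> resonant_set \<Psi> \<longleftrightarrow> f' 1 = 0"
    and "f' 1 = 0 \<Longrightarrow> coupling \<Psi> \<alpha> = f 1"
proof -
  let ?f = "\<lambda>x. complex_of_real (f x)"
  note fg = fundamental_pair_of_real[OF assms]
  have w: "w (-1) \<noteq> 0 \<and> w 1 = w (-1) * of_real (f 1) \<and> f' 1 = 0"
    if "resonant_solution \<Psi> \<alpha> w" for w
  proof -
    have sol: "sturm_solution (\<lambda>x. \<alpha> * \<Psi> x - 0\<^sup>2) w (dxi w)" and "dxi w (-1) = 0" "dxi w 1 = 0"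
      and nz: "\<exists>x\<in>{-1..1}. w x \<noteq> 0"
      using that by (auto simp: resonant_solution_def solves_iff)
    then have e: "w x = w (-1) * of_real (f x)" "dxi w x = w (-1) * of_real (f' x)" if "x \<in> {-1..1}" for x
      using sturm_solution_expansion[OF fg sol that] by auto
    have "w (-1) \<noteq> 0" using nz e(1) by (metis mult_zero_left)
    moreover have "w 1 = w (-1) * of_real (f 1)" by (rule e) simp
    moreover have "dxi w 1 = w (-1) * of_real (f' 1)" by (rule e) simp
    ultimately show ?thesis using \<open>dxi w 1 = 0\<close> by simp
  qed
  have f: "resonant_solution \<Psi> \<alpha> ?f" if "f' 1 = 0"
  proof -
    have s: "sturm_solution (\<lambda>x. \<alpha> * \<Psi> x - 0\<^sup>2) ?f (\<lambda>x. complex_of_real (f' x))"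
      and "?f (-1) = 1" "f' (-1) = 0"
      using fg assms by (auto simp: fundamental_pair_def)
    then show ?thesis
      unfolding resonant_solution_def
      using sturm_solution_imp_solves[OF s] dxi_eq[OF s] that by (auto intro!: bexI[of _ "-1"])
  qed
  show "\<alpha> \<in> resonant_set \<Psi> \<longleftrightarrow> f' 1 = 0"
    using w f by (auto simp: resonant_set_def)
  assume 0: "f' 1 = 0"
  have "?f (-1) = 1" using assms by (simp add: fundamental_pair_def)
  then show "coupling \<Psi> \<alpha> = f 1"
    unfolding coupling_def
  proof (intro the_equality)
    show "\<exists>w. resonant_solution \<Psi> \<alpha> w \<and> complex_of_real (f 1) = w 1 / w (-1)"
      using f[OF 0] \<open>?f (-1) = 1\<close> by (intro exI[of _ ?f]) simp
    fix t assume "\<exists>w. resonant_solution \<Psi> \<alpha> w \<and> complex_of_real t = w 1 / w (-1)"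
    then obtain w' where "resonant_solution \<Psi> \<alpha> w'" "complex_of_real t = w' 1 / w' (-1)" by blast
    with w[of w'] have "complex_of_real t = complex_of_real (f 1)" by simp
    then show "t = f 1" by (simp only: of_real_eq_iff)
  qed
qed

section \<open>Solving the matching conditions\<close>
lemma vector_4:
  fixes a b c d :: "'a::zero"
  shows "(vector [a, b, c, d] :: 'a ^ 4) $ 1 = a" "(vector [a, b, c, d] :: 'a ^ 4) $ 2 = b"
    "(vector [a, b, c, d] :: 'a ^ 4) $ 3 = c" "(vector [a, b, c, d] :: 'a ^ 4) $ 4 = d"
  unfolding vector_def by simp_all

text \<open>
  If both parts vanished, then \<open>c = \<kappa>\<^sup>2 b\<close> and \<open>d = - a\<close>, and the determinant would be
  \<open>- a\<^sup>2 - \<kappa>\<^sup>2 b\<^sup>2\<close>, which is never \<open>1\<close>.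
\<close>
lemma jost_denominator_nonzero:
  fixes a b c d \<kappa> :: real
  assumes "a * d - b * c = 1" and "\<kappa> > 0"
  shows "Complex (c - \<kappa>\<^sup>2 * b) (- \<kappa> * (a + d)) \<noteq> 0"
proof
  assume "Complex (c - \<kappa>\<^sup>2 * b) (- \<kappa> * (a + d)) = 0"
  then have "c = \<kappa>\<^sup>2 * b" "d = - a"
    using \<open>\<kappa> > 0\<close> by (auto simp: complex_eq_iff)
  then have "- (a\<^sup>2 + (\<kappa> * b)\<^sup>2) = 1" using assms(1) by (simp add: power2_eq_square algebra_simps)
  moreover have "a\<^sup>2 + (\<kappa> * b)\<^sup>2 \<ge> 0" by simp
  ultimately show False by linarith
qed

text \<open>
  The first two matching conditions express \<open>A\<close> and \<open>B\<close> through \<open>R\<close>. Eliminating \<open>T\<close> from the other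
  two leaves one equation for \<open>R\<close> with coefficient \<open>D\<close>, up to an exponential factor; the determinant
  \<open>1\<close> of the boundary values then collapses the numerator of \<open>T\<close> to \<open>- 2 \<i> \<kappa>\<close>.
\<close>
lemma scattering_coefficients:
  fixes f f' g g' :: "real \<Rightarrow> real"
  assumes fg: "fundamental_pair (\<lambda>x. \<alpha> * \<Psi> x - \<kappa>\<^sup>2) f f' g g'" and "\<kappa> > 0"
  defines "D \<equiv> Complex (f' 1 - \<kappa>\<^sup>2 * g 1) (- \<kappa> * (f 1 + g' 1))"
  shows "refl_coeff \<Psi> \<kappa> \<alpha> =
      - (exp (- \<i> * \<kappa>))\<^sup>2 * Complex (f' 1 + \<kappa>\<^sup>2 * g 1) (- \<kappa> * (f 1 - g' 1)) / D"
    and "trans_coeff \<Psi> \<kappa> \<alpha> = - 2 * \<i> * \<kappa> * (exp (- \<i> * \<kappa>))\<^sup>2 / D"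
proof -
  \<comment> \<open>\<open>k\<close> stands for \<open>\<i> \<kappa>\<close>, so that \<open>k * k\<close> is \<open>- \<kappa>\<^sup>2\<close> and all identities below are polynomial.\<close>
  define a b c d k where "a = complex_of_real (f 1)" and "b = complex_of_real (g 1)"
    and "c = complex_of_real (f' 1)" and "d = complex_of_real (g' 1)"
    and "k = \<i> * complex_of_real \<kappa>"
  define e e1 where "e = exp (\<i> * complex_of_real \<kappa>)" and "e1 = exp (- \<i> * complex_of_real \<kappa>)"
  define N where "N = Complex (f' 1 + \<kappa>\<^sup>2 * g 1) (- \<kappa> * (f 1 - g' 1))"
  have ee: "e * e1 = 1" by (simp add: e_def e1_def flip: exp_add)
  have W: "f 1 * g' 1 - g 1 * f' 1 = 1" using fundamental_pair_wronskian[OF fg, of 1] by simp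
  have W': "a * d - b * c = 1"
    unfolding a_def b_def c_def d_def using W by (simp flip: of_real_mult of_real_diff)
  have D0: "D \<noteq> 0" unfolding D_def by (rule jost_denominator_nonzero) (use W \<open>\<kappa> > 0\<close> in auto)
  have D: "D = c + k * k * b - k * (a + d)" and N: "N = c - k * k * b - k * (a - d)"
    by (auto simp: D_def N_def a_def b_def c_def d_def k_def complex_eq_iff power2_eq_square algebra_simps)
  have k_minus: "- \<i> * complex_of_real \<kappa> * e = - k * e" by (simp add: k_def)
  have system: "matching_matrix \<Psi> \<kappa> \<alpha> *v x = matching_rhs \<kappa> \<longleftrightarrow>
      - e * x $ 1 + x $ 2 = e1 \<and> k * e * x $ 1 + x $ 3 = k * e1 \<and>
      a * x $ 2 + b * x $ 3 - e * x $ 4 = 0 \<and> c * x $ 2 + d * x $ 3 - k * e * x $ 4 = 0" for x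
    unfolding matching_matrix_def matching_rhs_def Let_def sol_values[OF fg]
      e1_def[symmetric] e_def[symmetric]
    unfolding k_minus k_def[symmetric]
      a_def[symmetric] b_def[symmetric] c_def[symmetric] d_def[symmetric]
    by (simp add: vec_eq_iff forall_4 matrix_vector_mult_def sum_4 vector_4)
  define X where "X = (vector [- e1 * e1 * N / D, e1 * (D - N) / D, k * e1 * (D + N) / D,
      - 2 * k * e1 * e1 / D] :: complex ^ 4)"
  have "scattering_data \<Psi> \<kappa> \<alpha> = X"
    unfolding scattering_data_def
  proof (rule the_equality)
    have "- e * (- e1 * e1 * N) + e1 * (D - N) = e1 * D" using ee by algebra
    moreover have "k * e * (- e1 * e1 * N) + k * e1 * (D + N) = k * e1 * D" using ee by algebra
    moreover have "a * (e1 * (D - N)) + b * (k * e1 * (D + N)) - e * (- 2 * k * e1 * e1) = 0 * D"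
      unfolding D N using ee W' by algebra
    moreover have "c * (e1 * (D - N)) + d * (k * e1 * (D + N)) - k * e * (- 2 * k * e1 * e1) = 0 * D"
      unfolding D N using ee W' by algebra
    ultimately show "matching_matrix \<Psi> \<kappa> \<alpha> *v X = matching_rhs \<kappa>"
      unfolding system X_def vector_4 times_divide_eq_right
        add_divide_distrib[symmetric] diff_divide_distrib[symmetric]
      using D0 by simp
    fix x assume "matching_matrix \<Psi> \<kappa> \<alpha> *v x = matching_rhs \<kappa>"
    moreover obtain r A B t where x: "x $ 1 = r" "x $ 2 = A" "x $ 3 = B" "x $ 4 = t" by blast
    ultimately have eqs: "- e * r + A = e1" "k * e * r + B = k * e1"
      "a * A + b * B - e * t = 0" "c * A + d * B - k * e * t = 0"
      unfolding system by auto
    have A: "A = e1 + e * r" using eqs(1)[symmetric] by simp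
    have B: "B = k * e1 - k * e * r" using eqs(2)[symmetric] by simp
    have "e * (r * D) = - e1 * N"
      using eqs(3,4) unfolding A B D N by algebra
    then have r: "r * D = - e1 * e1 * N" using ee by algebra
    moreover have AD: "A * D = e1 * (D - N)" unfolding A using r ee by algebra
    moreover have BD: "B * D = k * e1 * (D + N)" unfolding B using r ee by algebra
    moreover have "t * D = - 2 * k * e1 * e1"
    proof -
      have "e * (t * D) = a * (e1 * (D - N)) + b * (k * e1 * (D + N))"
        using eqs(3) AD BD by algebra
      also have "\<dots> = - 2 * k * e1" unfolding D N using W' by algebra
      finally show ?thesis using ee by algebra
    qed
    ultimately show "x = X"
      
      unfolding vec_eq_iff forall_4 X_def vector_4 x by (simp only: eq_divide_imp[OF D0])
  qed
  then show "refl_coeff \<Psi> \<kappa> \<alpha> = - (exp (- \<i> * \<kappa>))\<^sup>2 * Complex (f' 1 + \<kappa>\<^sup>2 * g 1) (- \<kappa> * (f 1 - g' 1)) / D"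
    "trans_coeff \<Psi> \<kappa> \<alpha> = - 2 * \<i> * \<kappa> * (exp (- \<i> * \<kappa>))\<^sup>2 / D"
    unfolding refl_coeff_def trans_coeff_def
    by (simp_all add: X_def vector_4 N_def e1_def k_def power2_eq_square mult.assoc)
qed

section \<open>The limit of small frequency\<close>
lemma tendsto_of_quadratic_bound:
  fixes h :: "real \<Rightarrow> real"
  assumes "\<And>x. \<bar>x\<bar> \<le> 1 \<Longrightarrow> \<bar>h x - h 0\<bar> \<le> K * x\<^sup>2"
  shows "(h \<longlongrightarrow> h 0) (at_right 0)" and "((\<lambda>x. (h x - h 0) / x) \<longlongrightarrow> 0) (at_right 0)"
proof -
  have ev: "eventually (\<lambda>x. 0 < x \<and> x \<le> (1::real)) (at_right 0)"
    unfolding eventually_at_right_field by (auto intro: exI[of _ 1])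
  show "(h \<longlongrightarrow> h 0) (at_right 0)"
  proof (subst LIM_zero_iff[symmetric], rule Lim_null_comparison)
    show "eventually (\<lambda>x. norm (h x - h 0) \<le> K * x\<^sup>2) (at_right 0)"
      using ev by eventually_elim (use assms in auto)
    show "((\<lambda>x. K * x\<^sup>2) \<longlongrightarrow> 0) (at_right 0)" by (auto intro!: tendsto_eq_intros)
  qed
  show "((\<lambda>x. (h x - h 0) / x) \<longlongrightarrow> 0) (at_right 0)"
  proof (rule Lim_null_comparison)
    show "eventually (\<lambda>x. norm ((h x - h 0) / x) \<le> K * x) (at_right 0)"
      using ev
    proof eventually_elim
      case (elim x)
      then show ?case using assms[of x] by (simp add: abs_divide divide_le_eq power2_eq_square mult_ac)
    qed
    show "((\<lambda>x. K * x) \<longlongrightarrow> 0) (at_right 0)" by (auto intro!: tendsto_eq_intros)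
  qed
qed

text \<open>
  Up to exponential factors tending to \<open>1\<close>, \<open>R = - N / D\<close> and \<open>T = - 2 \<i> \<kappa> / D\<close>. If \<open>c 0 \<noteq> 0\<close>,
  both \<open>N\<close> and \<open>D\<close> tend to \<open>c 0\<close>, giving \<open>-1\<close> and \<open>0\<close>. If \<open>c 0 = 0\<close>, both vanish in the limit; divided
  by \<open>\<kappa>\<close> they tend to \<open>- \<i> (a - d)\<close> and \<open>- \<i> (a + d)\<close> at frequency \<open>0\<close>, where now \<open>a d = 1\<close> and \<open>a\<close> is
  the coupling constant.
\<close>
lemma scattering_limit:
  assumes \<Psi>: "continuous_on {-1..1} \<Psi>"
  shows "((\<lambda>\<kappa>. refl_coeff \<Psi> \<kappa> \<alpha>) \<longlongrightarrow> of_real (refl_limit \<Psi> \<alpha>)) (at_right 0)"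
    and "((\<lambda>\<kappa>. trans_coeff \<Psi> \<kappa> \<alpha>) \<longlongrightarrow> of_real (trans_limit \<Psi> \<alpha>)) (at_right 0)"
proof -
  obtain a b c d K where
    sol: "\<And>\<kappa>. \<bar>\<kappa>\<bar> \<le> 1 \<Longrightarrow> \<exists>f f' g g' :: real \<Rightarrow> real. fundamental_pair (\<lambda>x. \<alpha> * \<Psi> x - \<kappa>\<^sup>2) f f' g g' \<and>
       f 1 = a \<kappa> \<and> g 1 = b \<kappa> \<and> f' 1 = c \<kappa> \<and> g' 1 = d \<kappa>" and
    quad: "\<And>\<kappa>. \<bar>\<kappa>\<bar> \<le> 1 \<Longrightarrow> \<bar>a \<kappa> - a 0\<bar> \<le> K * \<kappa>\<^sup>2 \<and> \<bar>b \<kappa> - b 0\<bar> \<le> K * \<kappa>\<^sup>2 \<and>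
       \<bar>c \<kappa> - c 0\<bar> \<le> K * \<kappa>\<^sup>2 \<and> \<bar>d \<kappa> - d 0\<bar> \<le> K * \<kappa>\<^sup>2"
    by (rule monodromy_expansion[OF \<Psi>, of \<alpha>]) (rule that)
  have lim: "(a \<longlongrightarrow> a 0) (at_right 0)" "(b \<longlongrightarrow> b 0) (at_right 0)"
      "(c \<longlongrightarrow> c 0) (at_right 0)" "(d \<longlongrightarrow> d 0) (at_right 0)"
    and c_lim: "((\<lambda>\<kappa>. (c \<kappa> - c 0) / \<kappa>) \<longlongrightarrow> 0) (at_right 0)"
    by (rule tendsto_of_quadratic_bound[of _ K], simp add: quad)+
  obtain f f' g g' :: "real \<Rightarrow> real" where
    fg: "fundamental_pair (\<lambda>x. \<alpha> * \<Psi> x - 0\<^sup>2) f f' g g'"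
    and at0: "f 1 = a 0" "g 1 = b 0" "f' 1 = c 0" "g' 1 = d 0"
    using sol[of 0] by auto
  have det: "a 0 * d 0 - b 0 * c 0 = 1"
    using fundamental_pair_wronskian[OF fg, of 1] at0 by simp
  have resonant: "\<alpha> \<in> resonant_set \<Psi> \<longleftrightarrow> c 0 = 0" "c 0 = 0 \<Longrightarrow> coupling \<Psi> \<alpha> = a 0"
    using resonance[OF fg] at0 by auto
  define E where "E \<kappa> = (exp (- \<i> * complex_of_real \<kappa>))\<^sup>2" for \<kappa>
  define N where "N \<kappa> = Complex (c \<kappa> + \<kappa>\<^sup>2 * b \<kappa>) (- \<kappa> * (a \<kappa> - d \<kappa>))" for \<kappa>
  define D where "D \<kappa> = Complex (c \<kappa> - \<kappa>\<^sup>2 * b \<kappa>) (- \<kappa> * (a \<kappa> + d \<kappa>))" for \<kappa>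
  have ev: "eventually (\<lambda>x. 0 < x \<and> x \<le> (1::real)) (at_right 0)"
    unfolding eventually_at_right_field by (auto intro: exI[of _ 1])
  have coeff: "refl_coeff \<Psi> \<kappa> \<alpha> = - E \<kappa> * N \<kappa> / D \<kappa>"
    "trans_coeff \<Psi> \<kappa> \<alpha> = - 2 * \<i> * \<kappa> * E \<kappa> / D \<kappa>" if \<kappa>: "0 < \<kappa> \<and> \<kappa> \<le> 1" for \<kappa> :: real
  proof -
    obtain f f' g g' :: "real \<Rightarrow> real" where
      "fundamental_pair (\<lambda>x. \<alpha> * \<Psi> x - \<kappa>\<^sup>2) f f' g g'"
      "f 1 = a \<kappa>" "g 1 = b \<kappa>" "f' 1 = c \<kappa>" "g' 1 = d \<kappa>"
      using sol[of \<kappa>] \<kappa> by auto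
    with scattering_coefficients[OF this(1)] \<kappa> show "refl_coeff \<Psi> \<kappa> \<alpha> = - E \<kappa> * N \<kappa> / D \<kappa>"
      "trans_coeff \<Psi> \<kappa> \<alpha> = - 2 * \<i> * \<kappa> * E \<kappa> / D \<kappa>"
      by (simp_all add: E_def N_def D_def)
  qed
  have id: "((\<lambda>\<kappa>. \<kappa>) \<longlongrightarrow> (0::real)) (at_right 0)" by (rule tendsto_ident_at)
  have "(E \<longlongrightarrow> (exp (- \<i> * complex_of_real 0))\<^sup>2) (at_right 0)"
    unfolding E_def by (intro tendsto_intros id)
  then have E: "(E \<longlongrightarrow> 1) (at_right 0)" by simp
  have "((\<lambda>\<kappa>. - E \<kappa> * N \<kappa> / D \<kappa>) \<longlongrightarrow> of_real (refl_limit \<Psi> \<alpha>)) (at_right 0) \<and>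
    ((\<lambda>\<kappa>. - 2 * \<i> * \<kappa> * E \<kappa> / D \<kappa>) \<longlongrightarrow> of_real (trans_limit \<Psi> \<alpha>)) (at_right 0)"
  proof (cases "c 0 = 0")
    case False
    have "(N \<longlongrightarrow> Complex (c 0 + 0\<^sup>2 * b 0) (- 0 * (a 0 - d 0))) (at_right 0)"
      unfolding N_def by (intro tendsto_Complex tendsto_intros lim id)
    then have N: "(N \<longlongrightarrow> of_real (c 0)) (at_right 0)" by (simp add: complex_of_real_def)
    have "(D \<longlongrightarrow> Complex (c 0 - 0\<^sup>2 * b 0) (- 0 * (a 0 + d 0))) (at_right 0)"
      unfolding D_def by (intro tendsto_Complex tendsto_intros lim id)
    then have D: "(D \<longlongrightarrow> of_real (c 0)) (at_right 0)" by (simp add: complex_of_real_def)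
    have "((\<lambda>\<kappa>. - E \<kappa> * N \<kappa> / D \<kappa>) \<longlongrightarrow> - 1 * of_real (c 0) / of_real (c 0)) (at_right 0)"
      using False by (intro tendsto_intros E N D) auto
    moreover have "((\<lambda>\<kappa>. - 2 * \<i> * \<kappa> * E \<kappa> / D \<kappa>) \<longlongrightarrow> - 2 * \<i> * of_real 0 * 1 / of_real (c 0)) (at_right 0)"
      using False by (intro tendsto_intros E D id) auto
    ultimately show ?thesis
      using False resonant by (simp add: refl_limit_def trans_limit_def)
  next
    case True
    have a: "a 0 \<noteq> 0" using det True by auto
    then have d: "d 0 = 1 / a 0" using det True by (simp add: field_simps)
    have pos: "1 + (a 0)\<^sup>2 \<noteq> 0" using zero_le_power2[of "a 0"] by linarith
    have sum: "a 0 + d 0 = (1 + (a 0)\<^sup>2) / a 0" and diff: "a 0 - d 0 = - ((1 - (a 0)\<^sup>2) / a 0)"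
      using a by (simp_all add: d field_simps power2_eq_square)
    have imaginary: "Complex 0 (- y) = - \<i> * of_real y" for y by (simp add: complex_eq_iff)
    \<comment> \<open>\<open>N'\<close> and \<open>D'\<close> are \<open>N / \<kappa>\<close> and \<open>D / \<kappa>\<close>; \<open>c 0 = 0\<close> is inserted to bring in the difference
      quotient of \<open>c\<close>.\<close>
    define N' where "N' \<kappa> = Complex ((c \<kappa> - c 0) / \<kappa> + \<kappa> * b \<kappa>) (- (a \<kappa> - d \<kappa>))" for \<kappa>
    define D' where "D' \<kappa> = Complex ((c \<kappa> - c 0) / \<kappa> - \<kappa> * b \<kappa>) (- (a \<kappa> + d \<kappa>))" for \<kappa>
    have "(N' \<longlongrightarrow> Complex (0 + 0 * b 0) (- (a 0 - d 0))) (at_right 0)"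
      unfolding N'_def by (intro tendsto_Complex tendsto_intros lim c_lim id)
    then have N: "(N' \<longlongrightarrow> - \<i> * of_real (a 0 - d 0)) (at_right 0)"
      by (simp only: imaginary mult_zero_left add_0_right)
    have "(D' \<longlongrightarrow> Complex (0 - 0 * b 0) (- (a 0 + d 0))) (at_right 0)"
      unfolding D'_def by (intro tendsto_Complex tendsto_intros lim c_lim id)
    then have D: "(D' \<longlongrightarrow> - \<i> * of_real (a 0 + d 0)) (at_right 0)"
      by (simp only: imaginary mult_zero_left diff_zero)
    have nz: "- \<i> * complex_of_real (a 0 + d 0) \<noteq> 0" unfolding sum using a pos by (simp del: of_real_add)
    have "((\<lambda>\<kappa>. - E \<kappa> * N' \<kappa> / D' \<kappa>) \<longlongrightarrow>
        - 1 * (- \<i> * of_real (a 0 - d 0)) / (- \<i> * of_real (a 0 + d 0))) (at_right 0)"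
      by (intro tendsto_intros E N D nz)
    also have "- 1 * (- \<i> * of_real (a 0 - d 0)) / (- \<i> * of_real (a 0 + d 0)) = complex_of_real (refl_limit \<Psi> \<alpha>)"
    proof -
      have "- 1 * (- \<i> * of_real (a 0 - d 0)) / (- \<i> * of_real (a 0 + d 0))
          = complex_of_real (- (a 0 - d 0) / (a 0 + d 0))"
        using nz by (simp add: divide_simps)
      also have "- (a 0 - d 0) / (a 0 + d 0) = refl_limit \<Psi> \<alpha>"
        unfolding sum diff using resonant True a by (simp add: refl_limit_def)
      finally show ?thesis .
    qed
    finally have R: "((\<lambda>\<kappa>. - E \<kappa> * N' \<kappa> / D' \<kappa>) \<longlongrightarrow> of_real (refl_limit \<Psi> \<alpha>)) (at_right 0)" .
    have "((\<lambda>\<kappa>. - 2 * \<i> * E \<kappa> / D' \<kappa>) \<longlongrightarrow> - 2 * \<i> * 1 / (- \<i> * of_real (a 0 + d 0))) (at_right 0)"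
      by (intro tendsto_intros E D nz)
    also have "- 2 * \<i> * 1 / (- \<i> * of_real (a 0 + d 0)) = complex_of_real (trans_limit \<Psi> \<alpha>)"
    proof -
      have "- 2 * \<i> * 1 / (- \<i> * of_real (a 0 + d 0)) = complex_of_real (2 / (a 0 + d 0))"
        using nz by (simp add: divide_simps)
      also have "2 / (a 0 + d 0) = trans_limit \<Psi> \<alpha>"
        unfolding sum using resonant True a by (simp add: trans_limit_def)
      finally show ?thesis .
    qed
    finally have T: "((\<lambda>\<kappa>. - 2 * \<i> * E \<kappa> / D' \<kappa>) \<longlongrightarrow> of_real (trans_limit \<Psi> \<alpha>)) (at_right 0)" .
    have scale: "N \<kappa> = \<kappa> * N' \<kappa>" "D \<kappa> = \<kappa> * D' \<kappa>" if "0 < \<kappa>" for \<kappa>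
      using that True
      by (auto simp: N_def N'_def D_def D'_def complex_eq_iff field_simps power2_eq_square)
    have "eventually (\<lambda>\<kappa>. - E \<kappa> * N \<kappa> / D \<kappa> = - E \<kappa> * N' \<kappa> / D' \<kappa>) (at_right 0)"
      using ev by eventually_elim (simp add: scale)
    moreover have "eventually (\<lambda>\<kappa>. - 2 * \<i> * \<kappa> * E \<kappa> / D \<kappa> = - 2 * \<i> * E \<kappa> / D' \<kappa>) (at_right 0)"
      using ev by eventually_elim (simp add: scale)
    ultimately show ?thesis using R T by (simp only: tendsto_cong)
  qed
  moreover have "eventually (\<lambda>\<kappa>. refl_coeff \<Psi> \<kappa> \<alpha> = - E \<kappa> * N \<kappa> / D \<kappa>) (at_right 0)"
    "eventually (\<lambda>\<kappa>. trans_coeff \<Psi> \<kappa> \<alpha> = - 2 * \<i> * \<kappa> * E \<kappa> / D \<kappa>) (at_right 0)"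
    using ev by (auto elim!: eventually_mono simp: coeff)
  ultimately show "((\<lambda>\<kappa>. refl_coeff \<Psi> \<kappa> \<alpha>) \<longlongrightarrow> of_real (refl_limit \<Psi> \<alpha>)) (at_right 0)"
    "((\<lambda>\<kappa>. trans_coeff \<Psi> \<kappa> \<alpha>) \<longlongrightarrow> of_real (trans_limit \<Psi> \<alpha>)) (at_right 0)"
    by (simp_all only: tendsto_cong)
qed

lemma smooth_real_continuous_on: "smooth_real f \<Longrightarrow> continuous_on S f"
  unfolding smooth_real_def
  by (metis continuous_at_imp_continuous_on field_differentiable_imp_continuous_at funpow_0)

theorem theorem5p1:
  fixes \<Psi> :: "real \<Rightarrow> real" and k \<alpha> :: real
  assumes "delta_prime_like \<Psi>"
    and "k > 0"
  shows "((\<lambda>\<epsilon>. refl_coeff \<Psi> (\<epsilon> * k) \<alpha>) \<longlongrightarrow> complex_of_real (refl_limit \<Psi> \<alpha>)) (at_right 0)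
       \<and> ((\<lambda>\<epsilon>. trans_coeff \<Psi> (\<epsilon> * k) \<alpha>) \<longlongrightarrow> complex_of_real (trans_limit \<Psi> \<alpha>)) (at_right 0)"
proof -
  have "continuous_on {-1..1} \<Psi>"
    using assms(1) by (auto simp: delta_prime_like_def intro: smooth_real_continuous_on)
  moreover have "filterlim (\<lambda>\<epsilon>. \<epsilon> * k) (at_right 0) (at_right 0)"
    unfolding filterlim_at using \<open>k > 0\<close> eventually_at_right_less[of "0::real"]
    by (auto elim!: eventually_mono intro!: tendsto_eq_intros)
  ultimately show ?thesis
    using filterlim_compose[OF scattering_limit(1)] filterlim_compose[OF scattering_limit(2)] by blast
qed

end
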